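(* For every $\varepsilon>0$ there is $n_0$ such that for every $n\ge n_0$ there exists an $n$-component monotone network $f$ with \[ \lambda(f)\ \ge\ \left(\frac1e-\varepsilon\right)n^2 . \]
   Context: An $n$-component (Boolean) network is a function $f=(f_1,\dots,f_n):\{0,1\}^n\to\{0,1\}^n$. Write $[n]=\{1,\dots,n\}$. For $i\in[n]$ and $x\in\{0,1\}^n$, $f^i(x):=(x_1,\dots,x_{i-1},f_i(x),x_{i+1},\dots,x_n)$. For a word $w=i_1i_2\dots i_k$ over the alphabet $[n]$, $f^w:=f^{i_k}\circ\cdots\circ f^{i_1}$ (and $f^\epsilon=\mathrm{id}$ for the empty word). A word $w$ fixes $f$ if $f^w(x)$ is a fixed point of $f$ for every $x\in\{0,1\}^n$; the fixing length $\lambda(f)$ is the minimum length of a word fixing $f$. The network $f$ is monotone if $x\le y$ (componentwise) implies $f(x)\le f(y)$ for all $x,y$. (Monotone networks are known to admit fixing words.) Here $e$ is Euler's number. *)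

theory Defs
  imports Complex_Main "HOL-Library.FuncSet"
begin

text \<open>
  The set \<open>{0,1}^n\<close> is rendered as the extensional functions from \<open>{1..n}\<close> to \<^typ>\<open>bool\<close>.
  The componentwise order is the pointwise order of the function type, with \<open>False < True\<close>;
  all states agree outside \<open>{1..n}\<close>, so the coordinates there play no role.
\<close>

definition states :: "nat \<Rightarrow> (nat \<Rightarrow> bool) set" where
  "states n = {1..n} \<rightarrow>\<^sub>E UNIV"

definition network :: "nat \<Rightarrow> ((nat \<Rightarrow> bool) \<Rightarrow> nat \<Rightarrow> bool) \<Rightarrow> bool" where
  "network n f \<longleftrightarrow> f \<in> states n \<rightarrow> states n"

definition monotone_network :: "nat \<Rightarrow> ((nat \<Rightarrow> bool) \<Rightarrow> nat \<Rightarrow> bool) \<Rightarrow> bool" where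
  "monotone_network n f \<longleftrightarrow> network n f \<and> mono_on (states n) f"

definition update :: "((nat \<Rightarrow> bool) \<Rightarrow> nat \<Rightarrow> bool) \<Rightarrow> nat \<Rightarrow> (nat \<Rightarrow> bool) \<Rightarrow> nat \<Rightarrow> bool" where
  "update f i x = x(i := f x i)"

text \<open>The first letter of the word is applied first.\<close>

definition word_update ::
  "((nat \<Rightarrow> bool) \<Rightarrow> nat \<Rightarrow> bool) \<Rightarrow> nat list \<Rightarrow> (nat \<Rightarrow> bool) \<Rightarrow> nat \<Rightarrow> bool" where
  "word_update f w = fold (update f) w"

definition fixes_network :: "nat \<Rightarrow> ((nat \<Rightarrow> bool) \<Rightarrow> nat \<Rightarrow> bool) \<Rightarrow> nat list \<Rightarrow> bool" where
  "fixes_network n f w \<longleftrightarrow> w \<in> lists {1..n} \<and>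
     (\<forall>x\<in>states n. f (word_update f w x) = word_update f w x)"

text \<open>
  The value is only meaningful for networks admitting a fixing word; monotone networks do,
  by \<open>monotone_network_fixable\<close> below.
\<close>

definition fixing_length :: "nat \<Rightarrow> ((nat \<Rightarrow> bool) \<Rightarrow> nat \<Rightarrow> bool) \<Rightarrow> nat" where
  "fixing_length n f = (LEAST k. \<exists>w. fixes_network n f w \<and> length w = k)"

lemma update_in_states:
  assumes "network n f" "i \<in> {1..n}" "x \<in> states n"
  shows "update f i x \<in> states n"
  using assms by (auto simp: states_def update_def PiE_iff extensional_def)

lemma word_update_in_states:
  assumes "network n f" "w \<in> lists {1..n}" "x \<in> states n"
  shows "word_update f w x \<in> states n"
  using assms(2,3)
proof (induction w arbitrary: x rule: list.induct)
  case Nil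
  then show ?case by (simp add: word_update_def)
next
  case (Cons i w)
  have "update f i x \<in> states n"
    using Cons.prems by (intro update_in_states[OF assms(1)]) auto
  then show ?case using Cons by (simp add: word_update_def)
qed

lemma word_update_fixed_point: "f x = x \<Longrightarrow> word_update f w x = x"
  by (induction w) (simp_all add: word_update_def update_def)

lemma reach_fixed_point_down:
  assumes "monotone_network n f" "x \<in> states n" "f x \<le> x"
  shows "\<exists>w\<in>lists {1..n}. f (word_update f w x) = word_update f w x"
  using assms(2,3)
proof (induction "card {i\<in>{1..n}. x i}" arbitrary: x rule: less_induct)
  case less
  have net: "network n f" and mon: "mono_on (states n) f"
    using assms(1) by (auto simp: monotone_network_def)
  show ?case
  proof (cases "f x = x")
    case True
    then show ?thesis by (intro bexI[of _ "[]"]) (simp_all add: word_update_def)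
  next
    case False
    have fx: "f x \<in> states n" using net less.prems(1) by (auto simp: network_def)
    obtain i where i: "i \<in> {1..n}" "f x i \<noteq> x i"
      using False PiE_ext[OF fx[unfolded states_def] less.prems(1)[unfolded states_def]]
      by blast
    have xi: "x i" "\<not> f x i" using i(2) le_funD[OF less.prems(2), of i] by auto
    define y where "y = update f i x"
    have y: "y = x(i := False)" using xi by (simp add: y_def update_def)
    have yS: "y \<in> states n"
      unfolding y_def by (rule update_in_states[OF net i(1) less.prems(1)])
    have "y \<le> x" by (auto simp: y le_fun_def)
    then have fy: "f y \<le> f x" by (rule mono_onD[OF mon yS less.prems(1)])
    have "f y \<le> y"
      using le_funD[OF fy] le_funD[OF less.prems(2)] xi by (fastforce simp: y le_fun_def)
    moreover have "card {j\<in>{1..n}. y j} < card {j\<in>{1..n}. x j}"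
      using i(1) xi by (intro psubset_card_mono) (auto simp: y)
    ultimately obtain w where w: "w \<in> lists {1..n}"
        "f (word_update f w y) = word_update f w y"
      using less.hyps[of y] yS by blast
    then show ?thesis using i(1)
      by (intro bexI[of _ "i # w"]) (simp_all add: word_update_def y_def)
  qed
qed

lemma reach_fixed_point:
  assumes "monotone_network n f" "x \<in> states n"
  shows "\<exists>w\<in>lists {1..n}. f (word_update f w x) = word_update f w x"
  using assms(2)
proof (induction "card {i\<in>{1..n}. \<not> x i}" arbitrary: x rule: less_induct)
  case less
  have net: "network n f" using assms(1) by (auto simp: monotone_network_def)
  show ?case
  proof (cases "f x \<le> x")
    case True
    then show ?thesis using reach_fixed_point_down assms(1) less.prems by blast
  next
    case False
    have fx: "f x \<in> states n" using net less.prems by (auto simp: network_def)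
    obtain i where i: "f x i" "\<not> x i" using False by (auto simp: le_fun_def)
    have mem: "i \<in> {1..n}"
      using i fx less.prems unfolding states_def by (metis PiE_arb)
    define y where "y = update f i x"
    have y: "y = x(i := True)" using i by (simp add: y_def update_def)
    have yS: "y \<in> states n"
      unfolding y_def by (rule update_in_states[OF net mem less.prems])
    have "card {j\<in>{1..n}. \<not> y j} < card {j\<in>{1..n}. \<not> x j}"
      using mem i by (intro psubset_card_mono) (auto simp: y)
    then obtain w where w: "w \<in> lists {1..n}"
        "f (word_update f w y) = word_update f w y"
      using less.hyps[of y] yS by blast
    then show ?thesis using mem
      by (intro bexI[of _ "i # w"]) (simp_all add: word_update_def y_def)
  qed
qed

lemma monotone_network_fixable:
  assumes "monotone_network n f"
  shows "\<exists>w. fixes_network n f w"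
proof -
  have net: "network n f" using assms by (simp add: monotone_network_def)
  have "\<exists>w\<in>lists {1..n}. \<forall>x\<in>A. f (word_update f w x) = word_update f w x"
    if "finite A" "A \<subseteq> states n" for A
    using that
  proof (induction A rule: finite_induct)
    case empty
    then show ?case by auto
  next
    case (insert a A)
    then obtain w where w: "w \<in> lists {1..n}"
        "\<forall>x\<in>A. f (word_update f w x) = word_update f w x" by auto
    have "word_update f w a \<in> states n"
      using insert.prems by (intro word_update_in_states[OF net w(1)]) auto
    then obtain v where v: "v \<in> lists {1..n}"
        "f (word_update f v (word_update f w a)) = word_update f v (word_update f w a)"
      using reach_fixed_point[OF assms] by blast
    have app: "word_update f (w @ v) x = word_update f v (word_update f w x)" for x
      by (simp add: word_update_def)
    have "\<forall>x\<in>insert a A. f (word_update f (w @ v) x) = word_update f (w @ v) x"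
      using w(2) v(2) word_update_fixed_point[of f _ v] by (auto simp: app)
    then show ?case using w(1) v(1) by (intro bexI[of _ "w @ v"]) auto
  qed
  moreover have "finite (states n)" unfolding states_def by (intro finite_PiE) auto
  ultimately show ?thesis unfolding fixes_network_def by blast
qed

end

theory Submission
  imports Defs "HOL-Library.Sublist" "HOL-Combinatorics.Multiset_Permutations"
    "HOL-Real_Asymp.Real_Asymp"
begin

text \<open>
  From the all-false state, the path network along a permutation \<open>\<pi>\<close> whose first vertex is
  constantly true reaches its unique fixed point only under words having \<open>\<pi>\<close> as a subsequence.
  By AM-GM, a word of length \<open>L\<close> has at most \<open>(L / k) ^ k\<close> permutations of \<open>k\<close> letters as
  subsequences, an exponentially small fraction of all \<open>k! \<ge> (k / e) ^ k\<close> if \<open>L \<le> c * k\<^sup>2 / e\<close>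
  with \<open>c < 1\<close>. Hence for every such \<open>L\<close> a union bound yields a family of only polynomially many
  permutations that no word of length \<open>L\<close> contains simultaneously. A monotone network can choose
  among these paths by an antichain of states of \<open>O(log n)\<close> extra constant components, so it
  still has \<open>k = n - O(log n)\<close> path vertices.
\<close>

section \<open>Permutations embedded in a fixed word\<close>

text \<open>Induction on the word: a permutation embedded in \<open>a # w\<close> either embeds in
  \<open>w\<close> already, or starts with \<open>a\<close> and its tail, a permutation of
  \<open>K - {a}\<close>, embeds in \<open>w\<close>. The two counts add up as the product does when
  the factor of \<open>a\<close> grows by one.\<close>

lemma card_permutations_subseq_le:
  assumes "finite K"
  shows "card {\<pi> \<in> permutations_of_set K. subseq \<pi> w} \<le> (\<Prod>i\<in>K. count_list w i)"
  using assms
proof (induction w arbitrary: K)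
  case Nil
  show ?case
  proof (cases "K = {}")
    case True
    then have "{\<pi> \<in> permutations_of_set K. subseq \<pi> []} \<subseteq> {[]}" by auto
    from card_mono[OF _ this] True show ?thesis by simp
  next
    case False
    then have "{\<pi> \<in> permutations_of_set K. subseq \<pi> []} = {}"
      by (auto simp: permutations_of_set_def)
    then show ?thesis by (metis card.empty le0)
  qed
next
  case (Cons a w)
  let ?S = "\<lambda>K w. {\<pi> \<in> permutations_of_set K. subseq \<pi> w}"
  show ?case
  proof (cases "a \<in> K")
    case True
    have "?S K (a # w) \<subseteq> ?S K w \<union> (#) a ` ?S (K - {a}) w"
    proof
      fix \<pi> assume \<pi>: "\<pi> \<in> ?S K (a # w)"
      show "\<pi> \<in> ?S K w \<union> (#) a ` ?S (K - {a}) w"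
      proof (cases "subseq \<pi> w")
        case False
        with \<pi> obtain \<rho> where "\<pi> = a # \<rho>" "subseq \<rho> w"
          by (cases \<pi>) (auto split: if_splits)
        with \<pi> show ?thesis by (auto simp: permutations_of_set_def)
      qed (use \<pi> in auto)
    qed
    then have "card (?S K (a # w)) \<le> card (?S K w \<union> (#) a ` ?S (K - {a}) w)"
      using Cons.prems by (intro card_mono) auto
    also have "\<dots> \<le> card (?S K w) + card ((#) a ` ?S (K - {a}) w)"
      by (rule card_Un_le)
    also have "card ((#) a ` ?S (K - {a}) w) = card (?S (K - {a}) w)"
      by (rule card_image) simp
    also have "card (?S K w) + card (?S (K - {a}) w)
        \<le> (\<Prod>i\<in>K. count_list w i) + (\<Prod>i\<in>K - {a}. count_list w i)"
      using Cons by (intro add_mono) auto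
    also have "\<dots> = (count_list w a + 1) * (\<Prod>i\<in>K - {a}. count_list w i)"
      using Cons.prems True by (simp add: prod.remove)
    also have "(\<Prod>i\<in>K - {a}. count_list w i) = (\<Prod>i\<in>K - {a}. count_list (a # w) i)"
      by (rule prod.cong) auto
    also have "(count_list w a + 1) * \<dots> = (\<Prod>i\<in>K. count_list (a # w) i)"
      using Cons.prems True by (subst (2) prod.remove) auto
    finally show ?thesis .
  next
    case False
    have "?S K (a # w) \<subseteq> ?S K w"
    proof
      fix \<pi> assume \<pi>: "\<pi> \<in> ?S K (a # w)"
      with False show "\<pi> \<in> ?S K w"
        by (cases \<pi>) (auto simp: permutations_of_set_def split: if_splits)
    qed
    then have "card (?S K (a # w)) \<le> card (?S K w)"
      using Cons.prems by (intro card_mono) auto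
    also have "\<dots> \<le> (\<Prod>i\<in>K. count_list w i)" using Cons by simp
    also have "\<dots> = (\<Prod>i\<in>K. count_list (a # w) i)"
      using False by (intro prod.cong) auto
    finally show ?thesis .
  qed
qed

text \<open>AM-GM with an upper bound \<open>M\<close> on the mean: multiply the inequalities t
  \<le> exp (t - 1) at \<open>t = c i / M\<close>; the exponents sum to at most 0.\<close>

lemma prod_le_mean_power:
  fixes c :: "'a \<Rightarrow> real" and M :: real
  assumes "finite K" "\<And>i. i \<in> K \<Longrightarrow> c i \<ge> 0" "(\<Sum>i\<in>K. c i) \<le> card K * M" "M > 0"
  shows "(\<Prod>i\<in>K. c i) \<le> M ^ card K"
proof -
  have "(\<Prod>i\<in>K. c i) \<le> (\<Prod>i\<in>K. M * exp (c i / M - 1))"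
  proof (intro prod_mono conjI)
    fix i assume "i \<in> K"
    then show "c i \<ge> 0" by (rule assms)
    have "c i / M \<le> exp (c i / M - 1)" using exp_ge_add_one_self[of "c i / M - 1"] by simp
    then show "c i \<le> M * exp (c i / M - 1)" using \<open>M > 0\<close> by (simp add: field_simps)
  qed
  also have "\<dots> = M ^ card K * exp ((\<Sum>i\<in>K. c i) / M - card K)"
    using assms(1) by (simp add: prod.distrib exp_sum[symmetric] sum_subtractf sum_divide_distrib)
  also have "\<dots> \<le> M ^ card K * exp 0"
    using assms by (intro mult_left_mono) (auto simp: field_simps)
  finally show ?thesis by simp
qed

text \<open>\<open>k ^ k / fact k\<close> is a single term of the exponential series at
  \<open>k\<close>.\<close>

lemma power_le_fact_exp: "(real k / exp 1) ^ k \<le> fact k"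
proof -
  have "real k ^ k / fact k \<le> exp (real k)"
    using sum_le_suminf[OF sums_summable[OF exp_converges[of "real k"]], of "{k}"]
      sums_unique[OF exp_converges[of "real k"]]
    by (simp add: divide_inverse mult.commute)
  then show ?thesis by (simp add: power_divide exp_of_nat_mult[symmetric] field_simps)
qed

lemma sum_count_list_le_length: "finite K \<Longrightarrow> (\<Sum>i\<in>K. count_list w i) \<le> length w"
proof -
  assume "finite K"
  then have "(\<Sum>i\<in>K. count_list w i) \<le> (\<Sum>i\<in>K \<union> set w. count_list w i)"
    by (intro sum_mono2) auto
  also have "\<dots> = length w"
    using \<open>finite K\<close> by (intro sum_count_set) auto
  finally show ?thesis .
qed

text \<open>The hypothesis bounds the mean number of occurrences of a letter of \<open>K\<close> by
  \<open>M = c * (k / e)\<close>, so \<open>M ^ k\<close> splits into the fraction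
  \<open>c ^ k\<close> and a lower bound for \<open>k!\<close>.\<close>

lemma card_permutations_subseq_le_fact:
  fixes c :: real
  assumes "finite K" "K \<noteq> {}" "c > 0" "exp 1 * length w \<le> c * (card K)\<^sup>2"
  shows "card {\<pi> \<in> permutations_of_set K. subseq \<pi> w} \<le> c ^ card K * fact (card K)"
proof -
  define M where "M = c * (card K / exp 1)"
  have k: "card K > 0" using assms by (simp add: card_gt_0_iff)
  have "(\<Sum>i\<in>K. real (count_list w i)) \<le> length w"
    using of_nat_mono[OF sum_count_list_le_length[OF assms(1), of w], where 'a = real] by simp
  also have "\<dots> \<le> card K * M"
    using assms(4) by (simp add: M_def field_simps power2_eq_square)
  finally have sum: "(\<Sum>i\<in>K. real (count_list w i)) \<le> card K * M" .
  have "real (card {\<pi> \<in> permutations_of_set K. subseq \<pi> w}) \<le> (\<Prod>i\<in>K. real (count_list w i))"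
    using of_nat_mono[OF card_permutations_subseq_le[OF assms(1), of w], where 'a = real] by simp
  also have "\<dots> \<le> M ^ card K"
    using assms k sum by (intro prod_le_mean_power) (auto simp: M_def)
  also have "\<dots> = c ^ card K * (card K / exp 1) ^ card K"
    by (simp add: M_def power_mult_distrib power_divide)
  also have "\<dots> \<le> c ^ card K * fact (card K)"
    using assms(3) by (intro mult_left_mono power_le_fact_exp) auto
  finally show ?thesis .
qed

section \<open>Union bound over words\<close>

text \<open>Otherwise the families contained in a single word would cover all
  \<open>fact (card K) ^ card I\<close> families. Each word contains at most a fraction
  \<open>c ^ (card K * card I)\<close> of them, and there are only \<open>card V ^ L\<close>
  words.\<close>

lemma permutation_family_avoiding_words:
  fixes c :: real
  assumes fin: "finite V" "finite K" "finite I" and "K \<noteq> {}" "c > 0"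
    and len: "exp 1 * L \<le> c * (card K)\<^sup>2"
    and small: "card V ^ L * c ^ (card K * card I) < 1"
  shows "\<exists>\<pi>\<in>I \<rightarrow> permutations_of_set K. \<forall>w\<in>lists V. length w = L \<longrightarrow> (\<exists>a\<in>I. \<not> subseq (\<pi> a) w)"
proof (rule ccontr)
  assume contra: "\<not> ?thesis"
  define W where "W = {w. set w \<subseteq> V \<and> length w = L}"
  define S where "S w = {\<pi> \<in> permutations_of_set K. subseq \<pi> w}" for w
  have W: "finite W" "card W = card V ^ L"
    unfolding W_def using fin by (auto simp: finite_lists_length_eq card_lists_length_eq)
  have finS: "finite (S w)" for w by (simp add: S_def)
  have "I \<rightarrow>\<^sub>E permutations_of_set K \<subseteq> (\<Union>w\<in>W. I \<rightarrow>\<^sub>E S w)"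
  proof
    fix \<pi> assume \<pi>: "\<pi> \<in> I \<rightarrow>\<^sub>E permutations_of_set K"
    then have "\<pi> \<in> I \<rightarrow> permutations_of_set K" by auto
    then obtain w where "w \<in> lists V" "length w = L" "\<forall>a\<in>I. subseq (\<pi> a) w"
      using contra by blast
    then show "\<pi> \<in> (\<Union>w\<in>W. I \<rightarrow>\<^sub>E S w)"
      using \<pi> by (intro UN_I[of w]) (auto simp: W_def S_def PiE_iff lists_eq_set)
  qed
  then have "card (I \<rightarrow>\<^sub>E permutations_of_set K) \<le> card (\<Union>w\<in>W. I \<rightarrow>\<^sub>E S w)"
    using W fin finS by (intro card_mono finite_UN_I finite_PiE) auto
  also have "\<dots> \<le> (\<Sum>w\<in>W. card (I \<rightarrow>\<^sub>E S w))"
    using W by (intro card_UN_le) auto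
  also have "\<dots> = (\<Sum>w\<in>W. card (S w) ^ card I)"
    using fin by (simp add: card_PiE)
  finally have "fact (card K) ^ card I \<le> (\<Sum>w\<in>W. card (S w) ^ card I)"
    using fin by (simp add: card_PiE)
  then have "real (fact (card K) ^ card I) \<le> real (\<Sum>w\<in>W. card (S w) ^ card I)"
    by (rule of_nat_mono)
  then have "fact (card K) ^ card I \<le> (\<Sum>w\<in>W. real (card (S w)) ^ card I)"
    by simp
  also have "\<dots> \<le> (\<Sum>w\<in>W. (c ^ card K * fact (card K)) ^ card I)"
    unfolding S_def using assms
    by (intro sum_mono power_mono card_permutations_subseq_le_fact) (auto simp: W_def)
  also have "\<dots> = (card V ^ L * c ^ (card K * card I)) * fact (card K) ^ card I"
    using W by (simp add: power_mult_distrib power_mult)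
  also have "\<dots> < 1 * fact (card K) ^ card I"
    using small by (intro mult_strict_right_mono) auto
  finally show False by simp
qed

section \<open>The path selector network and its fixing words\<close>

text \<open>The indicator vector of \<open>A\<close> followed by that of its complement: enlarging
  \<open>A\<close> shrinks the second half, so distinct codes are incomparable.\<close>

definition code :: "nat \<Rightarrow> nat set \<Rightarrow> nat set" where
  "code p A = A \<union> (+) p ` ({1..p} - A)"

lemma code_subset: "A \<subseteq> {1..p} \<Longrightarrow> code p A \<subseteq> {1..2 * p}"
  by (auto simp: code_def)

lemma code_antichain:
  assumes "A \<subseteq> {1..p}" "B \<subseteq> {1..p}" "code p A \<subseteq> code p B"
  shows "A = B"
proof
  show "A \<subseteq> B" using assms by (fastforce simp: code_def)
  show "B \<subseteq> A"
  proof
    fix j assume j: "j \<in> B"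
    show "j \<in> A"
    proof (rule ccontr)
      assume "j \<notin> A"
      then have "p + j \<in> code p A" using j assms(2) unfolding code_def by blast
      then have "p + j \<in> code p B" using assms(3) by blast
      then show False using j subsetD[OF assms(2), of j] subsetD[OF assms(2), of "p + j"]
        by (auto simp: code_def)
    qed
  qed
qed

text \<open>
  The components \<open>1, \<dots>, 2 * p\<close> never change; when they spell out \<open>code p A\<close>, the remaining ones form
  the path network along \<open>\<pi> A\<close>, whose first vertex is constantly true.
\<close>

definition path_selector ::
    "nat \<Rightarrow> nat \<Rightarrow> (nat set \<Rightarrow> nat list) \<Rightarrow> (nat \<Rightarrow> bool) \<Rightarrow> nat \<Rightarrow> bool" where
  "path_selector n p \<pi> x = (\<lambda>i\<in>{1..n}. if i \<le> 2 * p then x i else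
     \<exists>A t. A \<subseteq> {1..p} \<and> (\<forall>j\<in>code p A. x j) \<and> t < length (\<pi> A) \<and> \<pi> A ! t = i \<and>
       (t = 0 \<or> x (\<pi> A ! (t - 1))))"

text \<open>No negation occurs: a path is enabled as soon as its code bits are true, whatever the
  other bits are.\<close>

lemma monotone_path_selector: "monotone_network n (path_selector n p \<pi>)"
proof -
  have "path_selector n p \<pi> x \<le> path_selector n p \<pi> y" if "x \<le> y" for x y
  proof -
    have "x j \<longrightarrow> y j" for j using that by (auto simp: le_fun_def)
    then have "path_selector n p \<pi> x i \<longrightarrow> path_selector n p \<pi> y i" for i
      unfolding path_selector_def restrict_def by (simp split: if_split) blast
    then show ?thesis by (simp add: le_fun_def)
  qed
  moreover have "path_selector n p \<pi> x \<in> states n" for x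
    unfolding states_def path_selector_def by auto
  ultimately show ?thesis
    by (auto simp: monotone_network_def network_def mono_on_def)
qed

text \<open>Start with exactly the bits of \<open>code p A\<close> true. Truth then enters at the
  first vertex of \<open>\<pi> A\<close> and advances along the path one update at a time, while a
  fixed point must have the whole path true.\<close>

lemma fixes_path_selector_imp_subseq:
  assumes p: "2 * p \<le> n" and \<pi>: "\<pi> A \<in> permutations_of_set {2 * p + 1..n}"
    and A: "A \<subseteq> {1..p}" and fixed: "fixes_network n (path_selector n p \<pi>) w"
  shows "subseq (\<pi> A) w"
proof -
  let ?f = "path_selector n p \<pi>"
  define z where "z = (\<lambda>i\<in>{1..n}. i \<in> code p A)"
  have codeA: "code p A \<subseteq> {1..2 * p}" by (rule code_subset[OF A])
  have set\<pi>: "set (\<pi> A) = {2 * p + 1..n}" and dist: "distinct (\<pi> A)"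
    using permutations_of_setD[OF \<pi>] by auto
  have range: "\<pi> A ! t \<in> {2 * p + 1..n}" if "t < length (\<pi> A)" for t
    using nth_mem[OF that] set\<pi> by simp
  \<comment> \<open>The antichain property excludes every path other than \<open>\<pi> A\<close>,
    and distinctness excludes every position other than \<open>t\<close>.\<close>
  have step: "?f x (\<pi> A ! t) \<longleftrightarrow> t = 0 \<or> x (\<pi> A ! (t - 1))"
    if t: "t < length (\<pi> A)" and x: "\<forall>j\<in>{1..2 * p}. x j \<longleftrightarrow> j \<in> code p A" for x t
  proof
    assume "?f x (\<pi> A ! t)"
    then obtain B s where B: "B \<subseteq> {1..p}" "\<forall>j\<in>code p B. x j" "s < length (\<pi> B)"
        "\<pi> B ! s = \<pi> A ! t" "s = 0 \<or> x (\<pi> B ! (s - 1))"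
      using range[OF t] by (auto simp: path_selector_def split: if_splits)
    have "code p B \<subseteq> code p A" using x B(2) code_subset[OF B(1)] by blast
    then have [simp]: "B = A" using code_antichain B(1) A by blast
    have "s = t" using B(3,4) t dist by (simp add: nth_eq_iff_index_eq)
    then show "t = 0 \<or> x (\<pi> A ! (t - 1))" using B(5) by simp
  next
    assume "t = 0 \<or> x (\<pi> A ! (t - 1))"
    moreover have "\<forall>j\<in>code p A. x j" using x codeA by blast
    ultimately have "\<exists>B s. B \<subseteq> {1..p} \<and> (\<forall>j\<in>code p B. x j) \<and> s < length (\<pi> B) \<and>
        \<pi> B ! s = \<pi> A ! t \<and> (s = 0 \<or> x (\<pi> B ! (s - 1)))"
      using t A by blast
    then show "?f x (\<pi> A ! t)"
      using range[OF t] by (simp add: path_selector_def)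
  qed
  \<comment> \<open>Invariant: the code is preserved, and a true vertex at position \<open>t\<close>
    certifies that the first \<open>t + 1\<close> path vertices were updated in order.\<close>
  have inv: "(\<forall>j\<in>{1..2 * p}. word_update ?f v z j \<longleftrightarrow> j \<in> code p A) \<and>
      (\<forall>t<length (\<pi> A). word_update ?f v z (\<pi> A ! t) \<longrightarrow> subseq (take (Suc t) (\<pi> A)) v)" for v
  proof (induction v rule: rev_induct)
    case Nil
    have "\<not> z (\<pi> A ! t)" if "t < length (\<pi> A)" for t
      using range[OF that] codeA by (auto simp: z_def)
    then show ?case using p by (auto simp: word_update_def z_def)
  next
    case (snoc i v)
    define x where "x = word_update ?f v z"
    have upd: "word_update ?f (v @ [i]) z = x(i := ?f x i)"
      by (simp add: word_update_def update_def x_def)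
    have x: "\<forall>j\<in>{1..2 * p}. x j \<longleftrightarrow> j \<in> code p A"
      and IH: "\<And>t. t < length (\<pi> A) \<Longrightarrow> x (\<pi> A ! t) \<Longrightarrow> subseq (take (Suc t) (\<pi> A)) v"
      using snoc by (auto simp: x_def)
    have "subseq (take (Suc t) (\<pi> A)) (v @ [i])"
      if t: "t < length (\<pi> A)" and one: "(x(i := ?f x i)) (\<pi> A ! t)" for t
    proof (cases "i = \<pi> A ! t")
      case True
      then have "t = 0 \<or> x (\<pi> A ! (t - 1))" using one step[OF t x] by simp
      then have "subseq (take t (\<pi> A)) v" using IH[of "t - 1"] t by (cases t) auto
      then show ?thesis using t True by (simp add: take_Suc_conv_app_nth)
    next
      case False
      then show ?thesis using one IH[OF t] by (auto intro: subseq_rev_drop_many)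
    qed
    moreover have "(x(i := ?f x i)) j \<longleftrightarrow> j \<in> code p A" if "j \<in> {1..2 * p}" for j
      using that x p by (auto simp: path_selector_def)
    ultimately show ?case unfolding upd by blast
  qed
  define x where "x = word_update ?f w z"
  have "z \<in> states n" by (auto simp: z_def states_def)
  then have fp: "?f x = x" using fixed by (simp add: fixes_network_def x_def)
  \<comment> \<open>At a fixed point the first vertex is true and each vertex copies its
    predecessor.\<close>
  have all: "x (\<pi> A ! t)" if "t < length (\<pi> A)" for t
    using that
  proof (induction t)
    case 0
    then show ?case using step[of 0 x] inv[of w] fp by (simp add: x_def[symmetric])
  next
    case (Suc t)
    then show ?case using step[of "Suc t" x] inv[of w] fp by (simp add: x_def[symmetric])
  qed
  show ?thesis
  proof (cases "length (\<pi> A)")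
    case (Suc t)
    then show ?thesis using all[of t] inv[of w] by (auto simp: x_def)
  qed auto
qed

section \<open>Lower bounds on the fixing length\<close>

lemma fixing_word_exists:
  assumes "monotone_network n f"
  obtains w where "fixes_network n f w" "length w = fixing_length n f"
proof -
  have "\<exists>k w. fixes_network n f w \<and> length w = k"
    using monotone_network_fixable[OF assms] by blast
  from LeastI_ex[OF this] show ?thesis using that unfolding fixing_length_def by blast
qed

lemma exists_monotone_network_fixing_length_gt:
  fixes c :: real
  assumes p: "2 * p < n" and c: "c > 0" and len: "exp 1 * L \<le> c * (real (n - 2 * p))\<^sup>2"
    and small: "n ^ L * c ^ ((n - 2 * p) * 2 ^ p) < 1"
  shows "\<exists>f. monotone_network n f \<and> fixing_length n f > L"
proof -
  let ?K = "{2 * p + 1..n}"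
  have "\<exists>\<pi>\<in>Pow {1..p} \<rightarrow> permutations_of_set ?K.
      \<forall>w\<in>lists {1..n}. length w = L \<longrightarrow> (\<exists>A\<in>Pow {1..p}. \<not> subseq (\<pi> A) w)"
    using assms by (intro permutation_family_avoiding_words[where c = c]) (auto simp: card_Pow)
  then obtain \<pi> where \<pi>: "\<pi> \<in> Pow {1..p} \<rightarrow> permutations_of_set ?K"
    and avoid: "\<And>w. w \<in> lists {1..n} \<Longrightarrow> length w = L \<Longrightarrow> \<exists>A\<in>Pow {1..p}. \<not> subseq (\<pi> A) w"
    by blast
  have mon: "monotone_network n (path_selector n p \<pi>)" by (rule monotone_path_selector)
  obtain w where w: "fixes_network n (path_selector n p \<pi>) w"
      "length w = fixing_length n (path_selector n p \<pi>)"
    using fixing_word_exists[OF mon] .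
  have "length w > L"
  proof (rule ccontr)
    assume short: "\<not> length w > L"
    \<comment> \<open>The family only avoids words of length exactly \<open>L\<close>; padding at
      the end keeps every subsequence of \<open>w\<close>.\<close>
    define v where "v = w @ replicate (L - length w) 1"
    have "v \<in> lists {1..n}" "length v = L"
      using short w(1) p by (auto simp: v_def fixes_network_def)
    then obtain A where A: "A \<subseteq> {1..p}" "\<not> subseq (\<pi> A) v" using avoid by blast
    have "subseq (\<pi> A) w"
      using p \<pi> A(1) by (intro fixes_path_selector_imp_subseq[OF _ _ _ w(1)]) auto
    then show False using A(2) by (auto simp: v_def intro: subseq_rev_drop_many)
  qed
  then show ?thesis using mon w(2) by auto
qed

section \<open>Asymptotics\<close>

lemma fixing_length_bound_eventually:
  fixes \<epsilon> :: real
  assumes "0 < \<epsilon>" "\<epsilon> < 1 / exp 1"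
  shows "eventually (\<lambda>n. \<exists>f. monotone_network n f \<and>
    real (fixing_length n f) \<ge> (1 / exp 1 - \<epsilon>) * (real n)\<^sup>2) sequentially"
proof -
  define \<alpha> where "\<alpha> = 1 / exp 1 - \<epsilon>"
  \<comment> \<open>The midpoint of \<open>exp 1 * \<alpha>\<close> and 1: the gap below absorbs the
    loss from \<open>n\<close> to \<open>n - 2 * p\<close>, the gap above makes
    \<open>c ^ (n - 2 * p)\<close> decay exponentially.\<close>
  define c where "c = 1 - exp 1 * \<epsilon> / 2"
  have eps: "0 < exp 1 * \<epsilon>" "exp 1 * \<epsilon> < 1" using assms by (auto simp: field_simps)
  have c: "0 < c" "c < 1" "exp 1 * \<alpha> / c < 1"
    using assms eps by (simp_all add: c_def \<alpha>_def right_diff_distrib)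
  have \<alpha>: "0 < \<alpha>" "\<alpha> < 1"
  proof -
    have "1 / exp 1 < (1::real)" by simp
    then show "0 < \<alpha>" "\<alpha> < 1" using assms unfolding \<alpha>_def by linarith+
  qed
  \<comment> \<open>A lower bound for the proportion \<open>(n - 2 * p) / n\<close> of path
    vertices, with \<open>p\<close> chosen below.\<close>
  define r where "r n = 1 - 2 * (2 * log 2 (real n) + 1) / real n" for n
  have r: "r \<longlonglongrightarrow> 1" unfolding r_def by real_asymp
  then have r2: "(\<lambda>n. (r n)\<^sup>2) \<longlonglongrightarrow> 1" by (auto intro: tendsto_eq_intros)
  have geom: "(\<lambda>n. real n * sqrt c ^ n) \<longlonglongrightarrow> 0"
    using c by (intro powser_times_n_limit_0) auto
  have "eventually (\<lambda>n. r n > 1 / 2) sequentially"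
    by (rule order_tendstoD(1)[OF r]) simp
  moreover have "eventually (\<lambda>n. (r n)\<^sup>2 > exp 1 * \<alpha> / c) sequentially"
    using c by (intro order_tendstoD(1)[OF r2]) simp
  moreover have "eventually (\<lambda>n. real n * sqrt c ^ n < 1) sequentially"
    by (rule order_tendstoD(2)[OF geom]) simp
  moreover have "eventually (\<lambda>n. n > 0) sequentially" by (rule eventually_gt_at_top)
  ultimately show ?thesis
  proof eventually_elim
    case (elim n)
    \<comment> \<open>Makes 2 ^ p \<ge> n ^ 2 \<ge> L, so that the union bound reduces to
      \<open>n * c ^ (n - 2 * p) < 1\<close>.\<close>
    define p where "p = nat \<lceil>2 * log 2 (real n)\<rceil>"
    \<comment> \<open>Rounding down costs nothing, since the fixing length will strictly exceed
      \<open>L\<close>.\<close>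
    define L where "L = nat \<lfloor>\<alpha> * (real n)\<^sup>2\<rfloor>"
    have log: "log 2 (real n) \<ge> 0" using elim by simp
    have p_le: "real p \<le> 2 * log 2 (real n) + 1" using log unfolding p_def by linarith
    have p_ge: "real p \<ge> 2 * log 2 (real n)" unfolding p_def by linarith
    have "(real n)\<^sup>2 = 2 powr (2 * log 2 (real n))"
      using elim by (simp add: powr_mult_base mult.commute[of 2] powr_powr[symmetric])
    also have "\<dots> \<le> 2 powr real p" using p_ge by simp
    finally have "real (n\<^sup>2) \<le> real (2 ^ p)" by (simp add: powr_realpow)
    then have pow: "n\<^sup>2 \<le> 2 ^ p" by (simp only: of_nat_le_iff)
    have "r n * n = n - 2 * (2 * log 2 (real n) + 1)"
      using elim by (simp add: r_def field_simps)
    then have k': "real n - 2 * real p \<ge> r n * n" using p_le by simp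
    have rn: "r n * n > 0" "r n * n \<ge> n / 2" using elim by auto
    have p: "2 * p < n" using k' rn by linarith
    then have k: "real (n - 2 * p) \<ge> r n * n" using k' by (simp add: of_nat_diff)
    have "0 \<le> \<alpha> * (real n)\<^sup>2" using \<alpha> by simp
    then have L: "real L \<le> \<alpha> * (real n)\<^sup>2" "\<alpha> * (real n)\<^sup>2 < real L + 1"
      unfolding L_def by linarith+
    have "exp 1 * real L \<le> exp 1 * \<alpha> * (real n)\<^sup>2" using L by simp
    also have "\<dots> \<le> c * (r n)\<^sup>2 * (real n)\<^sup>2"
      using elim c by (intro mult_right_mono) (auto simp: field_simps)
    also have "\<dots> = c * (r n * n)\<^sup>2" by (simp add: power_mult_distrib)
    also have "\<dots> \<le> c * (real (n - 2 * p))\<^sup>2"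
      using c k rn by (intro mult_left_mono power_mono) auto
    finally have len: "exp 1 * real L \<le> c * (real (n - 2 * p))\<^sup>2" .
    have "\<alpha> * (real n)\<^sup>2 \<le> 1 * (real n)\<^sup>2" using \<alpha> by (intro mult_right_mono) auto
    with L(1) have "real L \<le> (real n)\<^sup>2" by linarith
    then have "L \<le> n\<^sup>2" by (simp only: of_nat_power[symmetric] of_nat_le_iff)
    \<comment> \<open>At least half of the components lie on the path; this replaces the exponent
      \<open>n - 2 * p\<close> of \<open>c\<close> by the exponent \<open>n\<close> of
      \<open>sqrt c\<close>.\<close>
    have "n \<le> 2 * (n - 2 * p)" using k rn by linarith
    then have "sqrt c ^ (2 * (n - 2 * p)) \<le> sqrt c ^ n"
      using c by (intro power_decreasing) auto
    then have ck: "c ^ (n - 2 * p) \<le> sqrt c ^ n" using c by (simp add: power_mult)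
    have "real n ^ L * c ^ ((n - 2 * p) * 2 ^ p) \<le> real n ^ (n\<^sup>2) * c ^ ((n - 2 * p) * n\<^sup>2)"
      using c elim pow \<open>L \<le> n\<^sup>2\<close> by (intro mult_mono power_increasing power_decreasing) auto
    also have "\<dots> = (real n * c ^ (n - 2 * p)) ^ (n\<^sup>2)"
      by (simp add: power_mult_distrib power_mult)
    also have "\<dots> \<le> (real n * sqrt c ^ n) ^ (n\<^sup>2)"
      using ck c by (intro power_mono mult_left_mono) auto
    also have "\<dots> < 1"
      using elim c by (simp add: power_less_one_iff)
    finally have small: "real n ^ L * c ^ ((n - 2 * p) * 2 ^ p) < 1" .
    obtain f where "monotone_network n f" "fixing_length n f > L"
      using exists_monotone_network_fixing_length_gt[OF p c(1) len] small by auto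
    moreover from this(2) have "real (fixing_length n f) \<ge> \<alpha> * (real n)\<^sup>2"
      using L(2) by linarith
    ultimately show ?case unfolding \<alpha>_def by blast
  qed
qed

theorem theorem10:
  shows "\<forall>\<epsilon>::real. \<epsilon> > 0 \<longrightarrow>
    (\<exists>n0::nat. \<forall>n::nat. n \<ge> n0 \<longrightarrow>
      (\<exists>f. monotone_network n f \<and>
           real (fixing_length n f) \<ge> (1 / exp 1 - \<epsilon>) * (real n)\<^sup>2))"
proof (intro allI impI)
  fix \<epsilon> :: real assume "\<epsilon> > 0"
  \<comment> \<open>Capping \<epsilon> below 1 / e keeps the leading constant positive and only
    strengthens the bound.\<close>
  define \<delta> where "\<delta> = min \<epsilon> (1 / (2 * exp 1))"
  have "0 < \<delta>" "\<delta> < 1 / exp 1" using \<open>\<epsilon> > 0\<close> by (auto simp: \<delta>_def min_def field_simps)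
  from fixing_length_bound_eventually[OF this]
  obtain n0 where n0: "\<And>n. n \<ge> n0 \<Longrightarrow> \<exists>f. monotone_network n f \<and>
      real (fixing_length n f) \<ge> (1 / exp 1 - \<delta>) * (real n)\<^sup>2"
    by (auto simp: eventually_sequentially)
  have "(1 / exp 1 - \<epsilon>) * (real n)\<^sup>2 \<le> (1 / exp 1 - \<delta>) * (real n)\<^sup>2" for n
    by (intro mult_right_mono) (auto simp: \<delta>_def)
  then show "\<exists>n0. \<forall>n\<ge>n0. \<exists>f. monotone_network n f \<and>
      real (fixing_length n f) \<ge> (1 / exp 1 - \<epsilon>) * (real n)\<^sup>2"
    using n0 by (meson order_trans)
qed

end
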